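(* Let $\vec\alpha\,F$ be an $n$-ary BNF and $\sim$ a type-polymorphic family of relations on $\vec\alpha\,F$ which at every type is an equivalence relation and satisfies $x\sim y\Rightarrow\mathrm{map}_F\,\vec f\,x\sim\mathrm{map}_F\,\vec f\,y$ for all $\vec f$. Let $\vec\alpha\,Q$ be the quotient $\vec\alpha\,F/{\sim}$ with $\mathrm{map}_Q$ and $\mathrm{set}_{Q,i}$ as defined below. Then for every $x$ and every $i$, $$\mathrm{set}_{Q,i}\,[x]_\sim=\bigcap_{y\in[\mathrm{map}_F\,\vec{\mathfrak e}\,x]_\sim}\{a\mid\mathfrak e\,a\in\mathrm{set}_{F,i}\,y\}.$$
   Context: HOL setting (all types non-empty); vector notation $\vec x=x_1,\dots,x_n$ with synchronized indices. An $n$-ary BNF is a type constructor $\vec\alpha\,F$ with polymorphic mapper $\mathrm{map}_F::(\alpha_1\to\beta_1)\to\cdots\to(\alpha_n\to\beta_n)\to\vec\alpha\,F\to\vec\beta\,F$, setters $\mathrm{set}_{F,i}::\vec\alpha\,F\to\alpha_i\ \mathrm{set}$, infinite cardinal bound $\mathrm{bd}_F$, relator $\mathrm{rel}_F$, satisfying: $\mathrm{map}_F\,\vec{\mathrm{id}}=\mathrm{id}$; $\mathrm{map}_F\,\vec g\circ\mathrm{map}_F\,\vec f=\mathrm{map}_F\,\overrightarrow{(g\circ f)}$; $\mathrm{set}_{F,i}(\mathrm{map}_F\,\vec f\,x)=f_i\langle\mathrm{set}_{F,i}\,x\rangle$ (image); if $f_i z=g_i z$ for all $i$ and $z\in\mathrm{set}_{F,i}\,x$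 then $\mathrm{map}_F\,\vec f\,x=\mathrm{map}_F\,\vec g\,x$; $|\mathrm{set}_{F,i}\,x|\le\mathrm{bd}_F$; $(x,y)\in\mathrm{rel}_F\,\vec R$ iff some $z$ has $\mathrm{set}_{F,i}\,z\subseteq R_i$ for all $i$, $\mathrm{map}_F\,\overrightarrow{\mathrm{fst}}\,z=x$, $\mathrm{map}_F\,\overrightarrow{\mathrm{snd}}\,z=y$; $\mathrm{rel}_F\,\vec R\bullet\mathrm{rel}_F\,\vec S\subseteq\mathrm{rel}_F\,\overrightarrow{(R\bullet S)}$. Notation: $[x]_\sim=\{y\mid x\sim y\}$; $\mathsf 1+\alpha$ is the sum of the unit type and $\alpha$, with $\circledast$ the left injection of the unit element and $\mathfrak e::\alpha\to\mathsf 1+\alpha$ the right injection. The quotient $\vec\alpha\,Q$ consists of the $\sim$-equivalence classes $[x]_\sim$, with mapper $\mathrm{map}_Q\,\vec f\,[x]_\sim=[\mathrm{map}_F\,\vec f\,x]_\sim$. Define $Q_{\mathrm{in}}\,\vec A=\{q\mid\forall\vec f\,\vec g.\ (\forall i.\ \forall a\in A_i.\ f_i\,a=g_i\,a)\longrightarrow\mathrm{map}_Q\,\vec f\,q=\mathrm{map}_Q\,\vec g\,q\}$ with $f_i,g_i::\alpha_i\to\mathsf 1+\alpha_i$, and $\mathrm{set}_{Q,i}\,q=\bigcap\{A_i\mid q\in Q_{\mathrm{in}}\,\mathrm{UNIV}\cdots\mathrm{UNIV}\,A_i\,\mathrm{UNIV}\cdots\mathrm{UNIV}\}$, where $A_i$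 is in the $i$-th argument position and $\mathrm{UNIV}$ (the set of all elements of the respective type) in all others. *)

theory Defs
  imports "HOL-Library.FuncSet"
begin

unbundle cardinal_syntax

text \<open>
  HOL cannot quantify over polymorphic type constructors, so type polymorphism is internalised.
  A ``type'' is a nonempty set of elements of the universe \<open>'a univ\<close>, which is closed under the
  type constructions needed below (unit, sum, product). The base type \<open>'a\<close> is arbitrary: given
  any finite family of HOL types, take \<open>'a\<close> to be their sum; the types of the family are then
  pairwise disjoint subsets of the range of \<open>Atom\<close>.
\<close>

datatype 'a univ =
    Atom 'a
  | Star
  | InL "'a univ"
  | InR "'a univ"
  | Tup "'a univ" "'a univ"

text \<open>The two projections are only ever applied to elements of product types.\<close>

definition pfst :: "'a univ \<Rightarrow> 'a univ" where
  "pfst p = (case p of Tup a b \<Rightarrow> a | _ \<Rightarrow> undefined)"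

definition psnd :: "'a univ \<Rightarrow> 'a univ" where
  "psnd p = (case p of Tup a b \<Rightarrow> b | _ \<Rightarrow> undefined)"

definition unit_ty :: "'a univ set" where
  "unit_ty = {Star}"

definition sum_ty :: "'a univ set \<Rightarrow> 'a univ set \<Rightarrow> 'a univ set" where
  "sum_ty A B = InL ` A \<union> InR ` B"

definition graph_ty :: "('a univ \<times> 'a univ) set \<Rightarrow> 'a univ set" where
  "graph_ty R = {Tup a b | a b. (a, b) \<in> R}"

definition prod_ty :: "'a univ set \<Rightarrow> 'a univ set \<Rightarrow> 'a univ set" where
  "prod_ty A B = graph_ty (A \<times> B)"

text \<open>
  The finite type \<open>'n\<close> indexes the arguments of an \<open>n\<close>-ary type constructor. A vector of types
  \<open>\<alpha>\<^sub>1, \<dots>, \<alpha>\<^sub>n\<close> is a function from \<open>'n\<close> to types; different arguments may be different types.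
\<close>

type_synonym ('n, 'a) tys = "'n \<Rightarrow> 'a univ set"

definition is_tys :: "('n, 'a) tys \<Rightarrow> bool" where
  "is_tys A \<longleftrightarrow> (\<forall>i. A i \<noteq> {})"

text \<open>
  Vectors of functions \<open>\<alpha>\<^sub>i \<rightarrow> \<beta>\<^sub>i\<close>. The values outside \<open>A i\<close> are unconstrained and carry no
  information: two vectors that agree on each \<open>A i\<close> stand for the same vector of functions.
\<close>

definition funs :: "('n, 'a) tys \<Rightarrow> ('n, 'a) tys \<Rightarrow> ('n \<Rightarrow> 'a univ \<Rightarrow> 'a univ) set" where
  "funs A B = {f. \<forall>i. f i \<in> A i \<rightarrow> B i}"

text \<open>
  \<open>F A\<close> is the type \<open>\<alpha> F\<close>; \<open>mapF A B\<close>, \<open>setF A\<close> and \<open>relF A B\<close> are the instances of the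
  polymorphic mapper, setters and relator at the type vectors \<open>A\<close> and \<open>B\<close>.
\<close>

locale nary_bnf =
  fixes F :: "('n::finite, 'a) tys \<Rightarrow> 'f set"
    and mapF :: "('n, 'a) tys \<Rightarrow> ('n, 'a) tys \<Rightarrow> ('n \<Rightarrow> 'a univ \<Rightarrow> 'a univ) \<Rightarrow> 'f \<Rightarrow> 'f"
    and setF :: "('n, 'a) tys \<Rightarrow> 'n \<Rightarrow> 'f \<Rightarrow> 'a univ set"
    and bdF :: "'c rel"
    and relF :: "('n, 'a) tys \<Rightarrow> ('n, 'a) tys \<Rightarrow> ('n \<Rightarrow> 'a univ rel) \<Rightarrow> 'f rel"
  assumes F_nonempty: "is_tys A \<Longrightarrow> F A \<noteq> {}"
    and map_type: "\<lbrakk>is_tys A; is_tys B; f \<in> funs A B; x \<in> F A\<rbrakk> \<Longrightarrow> mapF A B f x \<in> F B"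
    and set_type: "\<lbrakk>is_tys A; x \<in> F A\<rbrakk> \<Longrightarrow> setF A i x \<subseteq> A i"
    and rel_type: "\<lbrakk>is_tys A; is_tys B; \<And>i. R i \<subseteq> A i \<times> B i\<rbrakk> \<Longrightarrow> relF A B R \<subseteq> F A \<times> F B"
    and map_id: "\<lbrakk>is_tys A; x \<in> F A\<rbrakk> \<Longrightarrow> mapF A A (\<lambda>i. id) x = x"
    and map_comp: "\<lbrakk>is_tys A; is_tys B; is_tys C; f \<in> funs A B; g \<in> funs B C; x \<in> F A\<rbrakk> \<Longrightarrow>
      mapF B C g (mapF A B f x) = mapF A C (\<lambda>i. g i \<circ> f i) x"
    and set_map: "\<lbrakk>is_tys A; is_tys B; f \<in> funs A B; x \<in> F A\<rbrakk> \<Longrightarrow>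
      setF B i (mapF A B f x) = f i ` setF A i x"
    and map_cong: "\<lbrakk>is_tys A; is_tys B; f \<in> funs A B; g \<in> funs A B; x \<in> F A;
      \<And>i z. z \<in> setF A i x \<Longrightarrow> f i z = g i z\<rbrakk> \<Longrightarrow> mapF A B f x = mapF A B g x"
    and bd_infinite: "Cinfinite bdF"
    and set_bd: "\<lbrakk>is_tys A; x \<in> F A\<rbrakk> \<Longrightarrow> |setF A i x| \<le>o bdF"
    and in_rel: "\<lbrakk>is_tys A; is_tys B; \<And>i. R i \<subseteq> A i \<times> B i; x \<in> F A; y \<in> F B\<rbrakk> \<Longrightarrow>
      (x, y) \<in> relF A B R \<longleftrightarrow>
      (\<exists>z \<in> F (\<lambda>i. prod_ty (A i) (B i)).
         (\<forall>i. setF (\<lambda>i. prod_ty (A i) (B i)) i z \<subseteq> graph_ty (R i)) \<and>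
         mapF (\<lambda>i. prod_ty (A i) (B i)) A (\<lambda>i. pfst) z = x \<and>
         mapF (\<lambda>i. prod_ty (A i) (B i)) B (\<lambda>i. psnd) z = y)"
    and rel_comp: "\<lbrakk>is_tys A; is_tys B; is_tys C; \<And>i. R i \<subseteq> A i \<times> B i; \<And>i. S i \<subseteq> B i \<times> C i\<rbrakk> \<Longrightarrow>
      relF A B R O relF B C S \<subseteq> relF A C (\<lambda>i. R i O S i)"

text \<open>\<open>E A\<close> is the instance of the relation \<open>\<sim>\<close> at the type vector \<open>A\<close>.\<close>

locale map_respecting_equiv =
  fixes F :: "('n::finite, 'a) tys \<Rightarrow> 'f set"
    and mapF :: "('n, 'a) tys \<Rightarrow> ('n, 'a) tys \<Rightarrow> ('n \<Rightarrow> 'a univ \<Rightarrow> 'a univ) \<Rightarrow> 'f \<Rightarrow> 'f"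
    and E :: "('n, 'a) tys \<Rightarrow> 'f rel"
  assumes equiv_E: "is_tys A \<Longrightarrow> equiv (F A) (E A)"
    and map_E: "\<lbrakk>is_tys A; is_tys B; f \<in> funs A B; (x, y) \<in> E A\<rbrakk> \<Longrightarrow>
      (mapF A B f x, mapF A B f y) \<in> E B"

definition Q :: "(('n, 'a) tys \<Rightarrow> 'f set) \<Rightarrow> (('n, 'a) tys \<Rightarrow> 'f rel) \<Rightarrow> ('n, 'a) tys \<Rightarrow> 'f set set" where
  "Q F E A = F A // E A"

text \<open>See \<open>mapQ_class\<close> below for the characteristic equation on equivalence classes.\<close>

definition mapQ ::
  "(('n, 'a) tys \<Rightarrow> ('n, 'a) tys \<Rightarrow> ('n \<Rightarrow> 'a univ \<Rightarrow> 'a univ) \<Rightarrow> 'f \<Rightarrow> 'f) \<Rightarrow>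
   (('n, 'a) tys \<Rightarrow> 'f rel) \<Rightarrow> ('n, 'a) tys \<Rightarrow> ('n, 'a) tys \<Rightarrow>
   ('n \<Rightarrow> 'a univ \<Rightarrow> 'a univ) \<Rightarrow> 'f set \<Rightarrow> 'f set" where
  "mapQ mapF E A B f q = (\<Union>x\<in>q. E B `` {mapF A B f x})"

lemma (in map_respecting_equiv) mapQ_class:
  assumes "is_tys A" "is_tys B" "f \<in> funs A B" "x \<in> F A"
  shows "mapQ mapF E A B f (E A `` {x}) = E B `` {mapF A B f x}"
proof -
  have "(\<lambda>x. E B `` {mapF A B f x}) respects E A"
    using assms by (auto simp: congruent_def intro!: equiv_class_eq[OF equiv_E] map_E)
  then show ?thesis
    unfolding mapQ_def using assms by (intro UN_equiv_class[OF equiv_E]) auto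
qed

text \<open>The vector \<open>\<one> + \<alpha>\<^sub>i\<close>; its new element is \<open>InL Star\<close>, and \<open>InR\<close> is the injection of \<open>\<alpha>\<^sub>i\<close>.\<close>

definition one_plus :: "('n, 'a) tys \<Rightarrow> ('n, 'a) tys" where
  "one_plus T = (\<lambda>i. sum_ty unit_ty (T i))"

text \<open>In both definitions \<open>T\<close> is the vector of ambient types, so that \<open>UNIV\<close> in argument \<open>j\<close>
  becomes \<open>T j\<close>.\<close>

definition Qin ::
  "(('n, 'a) tys \<Rightarrow> 'f set) \<Rightarrow>
   (('n, 'a) tys \<Rightarrow> ('n, 'a) tys \<Rightarrow> ('n \<Rightarrow> 'a univ \<Rightarrow> 'a univ) \<Rightarrow> 'f \<Rightarrow> 'f) \<Rightarrow>
   (('n, 'a) tys \<Rightarrow> 'f rel) \<Rightarrow> ('n, 'a) tys \<Rightarrow> ('n \<Rightarrow> 'a univ set) \<Rightarrow> 'f set set" where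
  "Qin F mapF E T A =
    {q \<in> Q F E T. \<forall>f \<in> funs T (one_plus T). \<forall>g \<in> funs T (one_plus T).
       (\<forall>i. \<forall>a \<in> A i. f i a = g i a) \<longrightarrow>
       mapQ mapF E T (one_plus T) f q = mapQ mapF E T (one_plus T) g q}"

definition setQ ::
  "(('n, 'a) tys \<Rightarrow> 'f set) \<Rightarrow>
   (('n, 'a) tys \<Rightarrow> ('n, 'a) tys \<Rightarrow> ('n \<Rightarrow> 'a univ \<Rightarrow> 'a univ) \<Rightarrow> 'f \<Rightarrow> 'f) \<Rightarrow>
   (('n, 'a) tys \<Rightarrow> 'f rel) \<Rightarrow> ('n, 'a) tys \<Rightarrow> 'n \<Rightarrow> 'f set \<Rightarrow> 'a univ set" where
  "setQ F mapF E T i q = \<Inter>{A. A \<subseteq> T i \<and> q \<in> Qin F mapF E T (T(i := A))}"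

end

theory Submission
  imports Defs
begin

text \<open>
  Each \<open>y \<sim> map\<^sub>F \<ee> x\<close> yields an admissible \<open>A = {a. \<ee> a \<in> set\<^sub>F\<^sub>,\<^sub>i y}\<close>: functions on \<open>\<alpha>\<close> that
  agree on \<open>A\<close> extend, by fixing the new point, to functions on \<open>\<one> + \<alpha>\<close> that agree on the atoms
  of \<open>y\<close>. Conversely, if \<open>A\<close> is admissible and \<open>a \<notin> A\<close>, then sending \<open>a\<close> to the new point instead of
  \<open>\<ee> a\<close> leaves the class unchanged and removes \<open>\<ee> a\<close> from the atoms of a representative.
\<close>

text \<open>The Kleisli extension for the monad 1 + _: it turns maps from \<open>T j\<close> to
  \<open>one_plus T j\<close> into endomaps of \<open>one_plus T j\<close>, which can then be
  applied to any \<open>y\<close> in the class of the embedded \<open>x\<close>. On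
  \<open>one_plus T j\<close> the catch-all branch covers exactly the new point
  \<open>InL Star\<close>.\<close>

definition ext_star :: "('a univ \<Rightarrow> 'a univ) \<Rightarrow> 'a univ \<Rightarrow> 'a univ" where
  "ext_star f u = (case u of InR a \<Rightarrow> f a | _ \<Rightarrow> InL Star)"

lemma ext_star_simps [simp]:
  "ext_star f (InR a) = f a"
  "ext_star f (InL u) = InL Star"
  by (simp_all add: ext_star_def)

lemma InR_in_one_plus [simp]: "InR a \<in> one_plus T j \<longleftrightarrow> a \<in> T j"
  by (auto simp: one_plus_def sum_ty_def unit_ty_def)

lemma Star_in_one_plus [simp]: "InL Star \<in> one_plus T j"
  by (auto simp: one_plus_def sum_ty_def unit_ty_def)

lemma one_plus_cases:
  assumes "u \<in> one_plus T j"
  obtains "u = InL Star" | a where "a \<in> T j" "u = InR a"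
  using assms by (auto simp: one_plus_def sum_ty_def unit_ty_def)

lemma is_tys_one_plus [simp]: "is_tys (one_plus T)"
  by (auto simp: is_tys_def one_plus_def sum_ty_def unit_ty_def)

lemma InR_funs_one_plus: "(\<lambda>j. InR) \<in> funs T (one_plus T)"
  by (auto simp: funs_def)

lemma ext_star_funs:
  assumes "f \<in> funs T (one_plus T)"
  shows "(\<lambda>j. ext_star (f j)) \<in> funs (one_plus T) (one_plus T)"
  using assms by (auto simp: funs_def Pi_iff elim!: one_plus_cases)

text \<open>Trades equality of classes for equivalence of representatives, so that both inclusions
  can be argued with \<open>mapF\<close> alone.\<close>

lemma mapQ_eq_iff:
  assumes "map_respecting_equiv F mapF E" "nary_bnf F mapF setF bdF relF"
    and "is_tys A" "is_tys B" "f \<in> funs A B" "g \<in> funs A B" "x \<in> F A"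
  shows "mapQ mapF E A B f (E A `` {x}) = mapQ mapF E A B g (E A `` {x}) \<longleftrightarrow>
    (mapF A B f x, mapF A B g x) \<in> E B"
proof -
  interpret map_respecting_equiv F mapF E by fact
  interpret nary_bnf F mapF setF bdF relF by fact
  show ?thesis
    using assms(3-) by (simp add: mapQ_class eq_equiv_class_iff[OF equiv_E] map_type)
qed

lemma class_in_Qin_atoms:
  assumes "map_respecting_equiv F mapF E" "nary_bnf F mapF setF bdF relF"
    and T: "is_tys T" and x: "x \<in> F T"
    and y: "(mapF T (one_plus T) (\<lambda>j. InR) x, y) \<in> E (one_plus T)"
  shows "E T `` {x} \<in> Qin F mapF E T (T(i := {a \<in> T i. InR a \<in> setF (one_plus T) i y}))"
    (is "_ \<in> Qin F mapF E T ?A")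
proof -
  interpret map_respecting_equiv F mapF E by fact
  interpret nary_bnf F mapF setF bdF relF by fact
  let ?P = "one_plus T"
  have equiv_P: "equiv (F ?P) (E ?P)" by (simp add: equiv_E)
  have yP: "y \<in> F ?P"
    using y equiv_P by (auto simp: equiv_def refl_on_def)
  \<comment> \<open>Moves the dependence on \<open>f\<close> from \<open>x\<close> to
    \<open>y\<close>: extending \<open>f\<close> and then composing with \<open>InR\<close> gives
    back \<open>f\<close>, so mapping the extension over both sides of assumption \<open>y\<close>
    relates the image of \<open>x\<close> under \<open>f\<close> to an image of
    \<open>y\<close>.\<close>
  have map_ext: "(mapF T ?P f x, mapF ?P ?P (\<lambda>j. ext_star (f j)) y) \<in> E ?P"
    if f: "f \<in> funs T ?P" for f
  proof -
    have "mapF ?P ?P (\<lambda>j. ext_star (f j)) (mapF T ?P (\<lambda>j. InR) x)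
        = mapF T ?P (\<lambda>j. ext_star (f j) \<circ> InR) x"
      using T x f by (intro map_comp) (auto simp: InR_funs_one_plus ext_star_funs)
    moreover have "(\<lambda>j. ext_star (f j) \<circ> InR) = f"
      by (simp add: fun_eq_iff)
    ultimately show ?thesis
      using map_E[OF _ _ ext_star_funs[OF f] y] by simp
  qed
  have "mapQ mapF E T ?P f (E T `` {x}) = mapQ mapF E T ?P g (E T `` {x})"
    if f: "f \<in> funs T ?P" and g: "g \<in> funs T ?P"
      and agree: "\<forall>j. \<forall>a \<in> ?A j. f j a = g j a" for f g
  proof -
    have "ext_star (f j) u = ext_star (g j) u" if u: "u \<in> setF ?P j y" for j u
    proof -
      have "u \<in> ?P j" using set_type[OF _ yP] u by auto
      then show ?thesis
      proof (cases rule: one_plus_cases)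
        case (2 a)
        \<comment> \<open>At \<open>j = i\<close> this is the definition of the atom set; at every
          other position \<open>?A j\<close> is all of \<open>T j\<close>.\<close>
        then have "a \<in> ?A j" using u by auto
        then show ?thesis using agree 2 by simp
      qed simp
    qed
    then have "mapF ?P ?P (\<lambda>j. ext_star (f j)) y = mapF ?P ?P (\<lambda>j. ext_star (g j)) y"
      using f g yP by (intro map_cong) (auto simp: ext_star_funs)
    \<comment> \<open>Both images of \<open>x\<close> are equivalent to one and the same image of
      \<open>y\<close>.\<close>
    then have "(mapF T ?P f x, mapF T ?P g x) \<in> E ?P"
      using map_ext[OF f] map_ext[OF g] equiv_P
      by (metis equiv_def symD transD)
    then show ?thesis
      using mapQ_eq_iff[OF assms(1,2) T _ f g x] by simp
  qed
  moreover have "E T `` {x} \<in> Q F E T"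
    using x by (simp add: Q_def quotientI)
  ultimately show ?thesis
    unfolding Qin_def by blast
qed

lemma Qin_class_mem:
  assumes "map_respecting_equiv F mapF E" "nary_bnf F mapF setF bdF relF"
    and T: "is_tys T" and x: "x \<in> F T"
    and A: "E T `` {x} \<in> Qin F mapF E T (T(i := A))"
    and a: "\<And>y. (mapF T (one_plus T) (\<lambda>j. InR) x, y) \<in> E (one_plus T) \<Longrightarrow>
      InR a \<in> setF (one_plus T) i y"
  shows "a \<in> A"
proof (rule ccontr)
  assume "a \<notin> A"
  interpret nary_bnf F mapF setF bdF relF by fact
  let ?P = "one_plus T"
  define g where "g = (\<lambda>j b. if j = i \<and> b = a then InL Star else InR b)"
  have g: "g \<in> funs T ?P"
    by (auto simp: g_def funs_def)
  have agree: "\<forall>j. \<forall>b \<in> (T(i := A)) j. InR b = g j b"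
    using \<open>a \<notin> A\<close> by (auto simp: g_def)
  have "\<forall>f \<in> funs T ?P. \<forall>g \<in> funs T ?P. (\<forall>j. \<forall>b \<in> (T(i := A)) j. f j b = g j b) \<longrightarrow>
      mapQ mapF E T ?P f (E T `` {x}) = mapQ mapF E T ?P g (E T `` {x})"
    using A unfolding Qin_def mem_Collect_eq by (rule conjunct2)
  from this[rule_format, OF InR_funs_one_plus g agree[rule_format]]
  have "mapQ mapF E T ?P (\<lambda>j. InR) (E T `` {x}) = mapQ mapF E T ?P g (E T `` {x})" .
  then have "(mapF T ?P (\<lambda>j. InR) x, mapF T ?P g x) \<in> E ?P"
    using mapQ_eq_iff[OF assms(1,2) T _ InR_funs_one_plus g x] by simp
  \<comment> \<open>The representative missing \<open>InR a\<close> is \<open>mapF T ?P g x\<close>: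
    \<open>g i\<close> sends \<open>a\<close> to \<open>InL Star\<close> and any other
    \<open>b\<close> to \<open>InR b\<close>.\<close>
  from a[OF this] have "InR a \<in> g i ` setF T i x"
    using set_map[OF T _ g x] by simp
  then show False
    by (auto simp: g_def split: if_splits)
qed

theorem theorem3p6:
  fixes F :: "('n::finite, 'a) tys \<Rightarrow> 'f set"
    and mapF :: "('n, 'a) tys \<Rightarrow> ('n, 'a) tys \<Rightarrow> ('n \<Rightarrow> 'a univ \<Rightarrow> 'a univ) \<Rightarrow> 'f \<Rightarrow> 'f"
    and setF :: "('n, 'a) tys \<Rightarrow> 'n \<Rightarrow> 'f \<Rightarrow> 'a univ set"
    and bdF :: "'c rel"
    and relF :: "('n, 'a) tys \<Rightarrow> ('n, 'a) tys \<Rightarrow> ('n \<Rightarrow> 'a univ rel) \<Rightarrow> 'f rel"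
    and E :: "('n, 'a) tys \<Rightarrow> 'f rel"
    and T :: "('n, 'a) tys"
    and x :: 'f
    and i :: 'n
  assumes "nary_bnf F mapF setF bdF relF"
    and "map_respecting_equiv F mapF E"
    and "is_tys T"
    and "x \<in> F T"
  shows "setQ F mapF E T i (E T `` {x}) =
    (\<Inter>y \<in> E (one_plus T) `` {mapF T (one_plus T) (\<lambda>j. InR) x}.
       {a \<in> T i. InR a \<in> setF (one_plus T) i y})"
proof (intro equalityI subsetI)
  fix a
  assume a: "a \<in> setQ F mapF E T i (E T `` {x})"
  show "a \<in> (\<Inter>y \<in> E (one_plus T) `` {mapF T (one_plus T) (\<lambda>j. InR) x}.
    {a \<in> T i. InR a \<in> setF (one_plus T) i y})"
  proof (rule INT_I)
    fix y
    assume "y \<in> E (one_plus T) `` {mapF T (one_plus T) (\<lambda>j. InR) x}"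
    \<comment> \<open>Each set on the right is itself one of the sets intersected in
      \<open>setQ\<close>.\<close>
    then have "E T `` {x} \<in> Qin F mapF E T (T(i := {a \<in> T i. InR a \<in> setF (one_plus T) i y}))"
      using class_in_Qin_atoms[OF assms(2,1,3,4)] by simp
    then show "a \<in> {a \<in> T i. InR a \<in> setF (one_plus T) i y}"
      using a unfolding setQ_def by (elim InterD) simp
  qed
next
  fix a
  assume a: "a \<in> (\<Inter>y \<in> E (one_plus T) `` {mapF T (one_plus T) (\<lambda>j. InR) x}.
    {a \<in> T i. InR a \<in> setF (one_plus T) i y})"
  show "a \<in> setQ F mapF E T i (E T `` {x})"
    unfolding setQ_def
  proof (rule InterI)
    \<comment> \<open>An admissible \<open>A\<close> need not be one of the atom sets; it is only
      shown to contain their intersection.\<close>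
    fix A
    assume "A \<in> {A. A \<subseteq> T i \<and> E T `` {x} \<in> Qin F mapF E T (T(i := A))}"
    then have A: "E T `` {x} \<in> Qin F mapF E T (T(i := A))" by simp
    show "a \<in> A"
      by (rule Qin_class_mem[OF assms(2,1,3,4) A]) (use a in simp)
  qed
qed

end
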